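(* For each $m\in\mathbb{N}$ with $m\geq 3$ there exists a natural number $\ell\in\mathbb{N}$ with $\ell\leq m$ such that there is a proper biharmonic map $\mathbb{R}^{m}\setminus\{0\}\rightarrow \mathbb{S}^{m^{\ell}}$.
   Context: $\mathbb{N}=\{1,2,\dots\}$. Here $\mathbb{R}^m\setminus\{0\}$ carries the Euclidean metric and $\mathbb{S}^{n}\subset\mathbb{R}^{n+1}$ is the unit sphere with the round metric. A smooth map $u\colon M\to\mathbb{S}^n\subset\mathbb{R}^{n+1}$ from a Riemannian manifold is harmonic if $\Delta u+|\nabla u|^2u=0$, and biharmonic if $$\Delta^2u+2\operatorname{div}(|\nabla u|^2\nabla u)-(\langle\Delta^2u,u\rangle-2|\nabla u|^4)u=0,$$ where $\Delta$ (Laplace–Beltrami operator, with negative spectrum), $\nabla$ and $\operatorname{div}$ act componentwise on $\mathbb{R}^{n+1}$-valued functions. A biharmonic map is proper if it is not harmonic. *)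

theory Defs
  imports "HOL-Analysis.Analysis"
begin

text \<open>
  Domains are open subsets of Euclidean space \<^typ>\<open>real ^ 'm\<close> with the Euclidean metric, so the
  Laplace--Beltrami operator is the usual (negative spectrum) Laplacian.  Since the dimension of
  the target has to be quantified inside a formula, a point of $R^{n+1}$ is a function
  \<^typ>\<open>nat \<Rightarrow> real\<close> vanishing at all indices above n, as in \<^const>\<open>Euclidean_space\<close> and
  \<^const>\<open>nsphere\<close>.
  All differential operators at a point depend only on the values of the function near that
  point; in particular values outside an open domain are irrelevant.
\<close>

definition partial_deriv :: "'m \<Rightarrow> (real ^ 'm::finite \<Rightarrow> real) \<Rightarrow> real ^ 'm \<Rightarrow> real" where
  "partial_deriv i f x = frechet_derivative f (at x) (axis i 1)"

definition gradient :: "(real ^ 'm::finite \<Rightarrow> real) \<Rightarrow> real ^ 'm \<Rightarrow> real ^ 'm" where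
  "gradient f x = (\<chi> i. partial_deriv i f x)"

definition divergence :: "(real ^ 'm::finite \<Rightarrow> real ^ 'm) \<Rightarrow> real ^ 'm \<Rightarrow> real" where
  "divergence X x = (\<Sum>i\<in>UNIV. partial_deriv i (\<lambda>y. X y $ i) x)"

definition laplacian :: "(real ^ 'm::finite \<Rightarrow> real) \<Rightarrow> real ^ 'm \<Rightarrow> real" where
  "laplacian f = divergence (gradient f)"

primrec Ck_on :: "nat \<Rightarrow> (real ^ 'm::finite) set \<Rightarrow> (real ^ 'm \<Rightarrow> real) \<Rightarrow> bool" where
  "Ck_on 0 S f \<longleftrightarrow> continuous_on S f"
| "Ck_on (Suc k) S f \<longleftrightarrow>
     (\<forall>x\<in>S. f differentiable at x) \<and> (\<forall>i. Ck_on k S (partial_deriv i f))"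

text \<open>
  A map into the sphere is smooth iff it is smooth as a map into the ambient Euclidean space,
  i.e. iff all its coordinate functions are.
\<close>

definition smooth_sphere_map ::
    "(real ^ 'm::finite) set \<Rightarrow> nat \<Rightarrow> (real ^ 'm \<Rightarrow> nat \<Rightarrow> real) \<Rightarrow> bool" where
  "smooth_sphere_map S n u \<longleftrightarrow>
     open S \<and> (\<forall>x\<in>S. u x \<in> topspace (nsphere n)) \<and>
     (\<forall>a\<le>n. \<forall>k. Ck_on k S (\<lambda>x. u x a))"

text \<open>The squared norm $|\nabla u|^2$ of the differential of an $R^{n+1}$-valued map.\<close>

definition grad_norm_sq :: "nat \<Rightarrow> (real ^ 'm::finite \<Rightarrow> nat \<Rightarrow> real) \<Rightarrow> real ^ 'm \<Rightarrow> real" where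
  "grad_norm_sq n u x = (\<Sum>a\<le>n. (norm (gradient (\<lambda>y. u y a) x))\<^sup>2)"

definition harmonic_sphere_map ::
    "(real ^ 'm::finite) set \<Rightarrow> nat \<Rightarrow> (real ^ 'm \<Rightarrow> nat \<Rightarrow> real) \<Rightarrow> bool" where
  "harmonic_sphere_map S n u \<longleftrightarrow>
     smooth_sphere_map S n u \<and>
     (\<forall>x\<in>S. \<forall>a\<le>n. laplacian (\<lambda>y. u y a) x + grad_norm_sq n u x * u x a = 0)"

definition biharmonic_sphere_map ::
    "(real ^ 'm::finite) set \<Rightarrow> nat \<Rightarrow> (real ^ 'm \<Rightarrow> nat \<Rightarrow> real) \<Rightarrow> bool" where
  "biharmonic_sphere_map S n u \<longleftrightarrow>
     smooth_sphere_map S n u \<and>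
     (\<forall>x\<in>S. \<forall>a\<le>n.
        laplacian (laplacian (\<lambda>y. u y a)) x
        + 2 * divergence (\<lambda>y. grad_norm_sq n u y *\<^sub>R gradient (\<lambda>z. u z a) y) x
        - ((\<Sum>b\<le>n. laplacian (laplacian (\<lambda>y. u y b)) x * u x b)
           - 2 * (grad_norm_sq n u x)\<^sup>2) * u x a = 0)"

definition proper_biharmonic_sphere_map ::
    "(real ^ 'm::finite) set \<Rightarrow> nat \<Rightarrow> (real ^ 'm \<Rightarrow> nat \<Rightarrow> real) \<Rightarrow> bool" where
  "proper_biharmonic_sphere_map S n u \<longleftrightarrow>
     biharmonic_sphere_map S n u \<and> \<not> harmonic_sphere_map S n u"

end

theory Submission
  imports Defs
begin

text \<open>
  The map comes from the traceless symmetric square of the position vector.  The polynomials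
  $p_{ij}(x) = x_i x_j - \delta_{ij} |x|^2/m$ are harmonic, homogeneous of degree 2, and the sum of
  their squares is $(1 - 1/m) |x|^4$.  Hence the quotients $p_{ij}/|x|^2$, suitably scaled, are the
  coordinates of a map $v$ into the unit sphere of dimension $m^2 - 1$ which is constant along rays and
  whose restriction to the unit sphere consists of spherical harmonics of eigenvalue $\mu = 2m$.
  Such a $v$ is a harmonic map: $\Delta v = -\mu |x|^{-2} v$.

  It is pushed into a parallel of the next larger sphere: $u = (\sqrt\sigma\, v, \sqrt{1-\sigma})$
  with $0 < \sigma < 1$.  Such a $u$ cannot be harmonic, because its last coordinate is a nonzero
  constant while $|\nabla u|^2 = \sigma\mu |x|^{-2}$ does not vanish.  On the other hand
  $$\Delta^2 u = \mu(\mu + 2(m-4)) |x|^{-4} (\sqrt\sigma\, v, 0), \qquad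
    2 \mathrm{div}(|\nabla u|^2 \nabla u) = -2\sigma\mu^2 |x|^{-4} (\sqrt\sigma\, v, 0),$$
  and $2 |\nabla u|^4 = 2\sigma^2\mu^2 |x|^{-4}$.  If $2\sigma\mu = \mu + 2(m-4)$, then the two vectors
  cancel, and the factor $\langle\Delta^2 u, u\rangle - 2|\nabla u|^4$ vanishes as well, so $u$ is
  biharmonic.  This is \<open>proper_biharmonic_of_homogeneous_harmonics\<close>, for homogeneous harmonic functions of
  any even degree.  For $\mu = 2m$ the condition reads $\sigma = (m-2)/m$, which lies strictly between
  0 and 1 as soon as $m \geq 3$.  The exponent $\ell = 2$ therefore serves every dimension.
\<close>

section \<open>Calculus of partial derivatives\<close>

lemma partial_deriv_eq:
  assumes "(f has_derivative f') (at x)"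
  shows "partial_deriv i f x = f' (axis i 1)"
  using frechet_derivative_at[OF assms] by (simp add: partial_deriv_def)

lemma partial_deriv_cong:
  assumes "open S" "x \<in> S" "\<And>y. y \<in> S \<Longrightarrow> f y = g y"
  shows "partial_deriv i f x = partial_deriv i g x"
proof -
  have "(f has_derivative D) (at x) \<longleftrightarrow> (g has_derivative D) (at x)" for D
    using assms by (auto intro: has_derivative_transform_within_open)
  then show ?thesis
    by (simp add: partial_deriv_def frechet_derivative_def)
qed

lemma partial_deriv_const [simp]: "partial_deriv i (\<lambda>y. c) x = 0"
  by (subst partial_deriv_eq[OF has_derivative_const]) simp

lemma partial_deriv_component [simp]: "partial_deriv i (\<lambda>y. y $ j) x = (if i = j then 1 else 0)"
  by (subst partial_deriv_eq[OF bounded_linear_imp_has_derivative])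
     (auto simp: axis_def intro: bounded_linear_vec_nth)

lemma partial_deriv_add:
  assumes "f differentiable at x" "g differentiable at x"
  shows "partial_deriv i (\<lambda>y. f y + g y) x = partial_deriv i f x + partial_deriv i g x"
  by (subst partial_deriv_eq[OF has_derivative_add])
     (use assms in \<open>auto simp: partial_deriv_def frechet_derivative_works\<close>)

lemma partial_deriv_sum:
  assumes "\<And>a. a \<in> A \<Longrightarrow> f a differentiable at x"
  shows "partial_deriv i (\<lambda>y. \<Sum>a\<in>A. f a y) x = (\<Sum>a\<in>A. partial_deriv i (f a) x)"
  by (subst partial_deriv_eq[OF has_derivative_sum])
     (use assms in \<open>auto simp: partial_deriv_def frechet_derivative_works\<close>)

lemma partial_deriv_mult:
  assumes "f differentiable at x" "g differentiable at x"
  shows "partial_deriv i (\<lambda>y. f y * g y) x = f x * partial_deriv i g x + partial_deriv i f x * g x"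
  by (subst partial_deriv_eq[OF has_derivative_mult])
     (use assms in \<open>auto simp: partial_deriv_def frechet_derivative_works\<close>)

lemma partial_deriv_cmult:
  assumes "f differentiable at x"
  shows "partial_deriv i (\<lambda>y. c * f y) x = c * partial_deriv i f x"
  using partial_deriv_mult[of "\<lambda>_. c" x f i] assms by simp

lemma partial_deriv_inverse:
  assumes "f differentiable at x" "f x \<noteq> 0"
  shows "partial_deriv i (\<lambda>y. inverse (f y)) x = - partial_deriv i f x * (inverse (f x))\<^sup>2"
  by (subst partial_deriv_eq[OF Deriv.has_derivative_inverse])
     (use assms in \<open>auto simp: partial_deriv_def frechet_derivative_works power2_eq_square\<close>)

section \<open>Functions of class \<open>C\<^sup>k\<close>\<close>

lemma Ck_on_cong:
  assumes "open S" "\<And>y. y \<in> S \<Longrightarrow> f y = g y"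
  shows "Ck_on k S f \<longleftrightarrow> Ck_on k S g"
  using assms(2)
proof (induction k arbitrary: f g)
  case 0
  then show ?case using continuous_on_cong[of S S f g] by simp
next
  case (Suc k)
  have "f differentiable at x \<longleftrightarrow> g differentiable at x" if "x \<in> S" for x
    using Suc.prems that assms(1) unfolding differentiable_def
    by (metis has_derivative_transform_within_open)
  moreover have "Ck_on k S (partial_deriv i f) \<longleftrightarrow> Ck_on k S (partial_deriv i g)" for i
    using Suc.prems by (intro Suc.IH partial_deriv_cong[OF assms(1)])
  ultimately show ?case by simp
qed

lemma Ck_on_SucD: "Ck_on (Suc k) S f \<Longrightarrow> Ck_on k S f"
proof (induction k arbitrary: f)
  case 0
  then show ?case
    by (auto simp: continuous_on_eq_continuous_at continuous_at_imp_continuous_on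
        intro!: continuous_at_imp_continuous_on differentiable_imp_continuous_within)
next
  case (Suc k)
  have "Ck_on k S (partial_deriv i f)" for i using Suc.prems by (intro Suc.IH) simp
  with Suc.prems show ?case by simp
qed

lemma Ck_on_const [simp]: "Ck_on k S (\<lambda>y. c)"
proof (induction k arbitrary: c)
  case (Suc k)
  have "partial_deriv i (\<lambda>y. c) = (\<lambda>y. 0)" for i :: 'a by auto
  with Suc show ?case by simp
qed simp

lemma Ck_on_component: "Ck_on k S (\<lambda>y. y $ j)"
proof (cases k)
  case (Suc k')
  have "partial_deriv i (\<lambda>y. y $ j) = (\<lambda>y. if i = j then 1 else 0)" for i by auto
  with Suc show ?thesis
    by (auto simp: bounded_linear_vec_nth intro: bounded_linear_imp_differentiable)
qed (auto intro: continuous_intros)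

lemma Ck_on_add:
  assumes "open S" "Ck_on k S f" "Ck_on k S g"
  shows "Ck_on k S (\<lambda>y. f y + g y)"
  using assms(2,3)
proof (induction k arbitrary: f g)
  case (Suc k)
  have "Ck_on k S (partial_deriv i (\<lambda>y. f y + g y))" for i
    by (subst Ck_on_cong[OF assms(1) partial_deriv_add]) (use Suc in auto)
  with Suc.prems show ?case by simp
qed (auto intro: continuous_intros)

lemma Ck_on_mult:
  assumes "open S" "Ck_on k S f" "Ck_on k S g"
  shows "Ck_on k S (\<lambda>y. f y * g y)"
  using assms(2,3)
proof (induction k arbitrary: f g)
  case (Suc k)
  have "Ck_on k S (partial_deriv i (\<lambda>y. f y * g y))" for i
    by (subst Ck_on_cong[OF assms(1) partial_deriv_mult])
       (use Suc.prems Suc.prems[THEN Ck_on_SucD] in \<open>auto intro!: Ck_on_add[OF assms(1)] Suc.IH\<close>)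
  with Suc.prems show ?case by simp
qed (auto intro: continuous_intros)

lemma Ck_on_sum:
  assumes "open S" "\<And>a. a \<in> A \<Longrightarrow> Ck_on k S (f a)"
  shows "Ck_on k S (\<lambda>y. \<Sum>a\<in>A. f a y)"
  using assms(2)
  by (induction A rule: infinite_finite_induct) (auto intro: Ck_on_add[OF assms(1)])

text \<open>
  The derivative of a reciprocal again contains only that reciprocal and a derivative of the
  original function, so the induction on the order closes on itself.
\<close>

lemma Ck_on_inverse:
  assumes "open S" "Ck_on k S f" "\<And>y. y \<in> S \<Longrightarrow> f y \<noteq> 0"
  shows "Ck_on k S (\<lambda>y. inverse (f y))"
  using assms(2)
proof (induction k)
  case 0
  with assms(3) show ?case by (auto intro: continuous_intros)
next
  case (Suc k)
  have inv: "Ck_on k S (\<lambda>y. inverse (f y))" by (rule Suc.IH[OF Ck_on_SucD[OF Suc.prems]])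
  have "Ck_on k S (\<lambda>y. (-1) * partial_deriv i f y * (inverse (f y) * inverse (f y)))" for i
    by (intro Ck_on_mult assms(1) inv Ck_on_const) (use Suc.prems in simp)
  then have "Ck_on k S (partial_deriv i (\<lambda>y. inverse (f y)))" for i
    by (subst Ck_on_cong[OF assms(1) partial_deriv_inverse])
       (use Suc.prems assms(3) in \<open>auto simp: power2_eq_square\<close>)
  with Suc.prems assms(3) show ?case by (simp add: differentiable_inverse)
qed

lemma Ck_on_power:
  assumes "open S" "Ck_on k S f"
  shows "Ck_on k S (\<lambda>y. f y ^ n)"
  by (induction n) (auto intro: Ck_on_mult[OF assms(1) assms(2)])

lemmas Ck_on_intros = Ck_on_const Ck_on_component Ck_on_add Ck_on_mult Ck_on_sum Ck_on_power

lemma Ck_on_2D: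
  assumes "Ck_on 2 S f" "x \<in> S"
  shows "f differentiable at x" "partial_deriv i f differentiable at x"
  using assms by (auto simp: numeral_2_eq_2)

section \<open>Gradient, divergence and Laplacian\<close>

lemma laplacian_eq: "laplacian f x = (\<Sum>i\<in>UNIV. partial_deriv i (partial_deriv i f) x)"
  by (simp add: laplacian_def divergence_def gradient_def)

lemma inner_gradient: "gradient f x \<bullet> v = (\<Sum>i\<in>UNIV. partial_deriv i f x * v $ i)"
  by (simp add: gradient_def inner_vec_def)

lemma gradient_cong:
  assumes "open S" "x \<in> S" "\<And>y. y \<in> S \<Longrightarrow> f y = g y"
  shows "gradient f x = gradient g x"
  unfolding gradient_def by (subst partial_deriv_cong[OF assms]) auto

lemma divergence_cong:
  assumes "open S" "x \<in> S" "\<And>y. y \<in> S \<Longrightarrow> X y = Y y"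
  shows "divergence X x = divergence Y x"
  unfolding divergence_def using assms(3) by (intro sum.cong partial_deriv_cong[OF assms(1,2)]) auto

lemma laplacian_cong:
  assumes "open S" "x \<in> S" "\<And>y. y \<in> S \<Longrightarrow> f y = g y"
  shows "laplacian f x = laplacian g x"
  unfolding laplacian_def
  by (intro divergence_cong[OF assms(1,2)] gradient_cong[OF assms(1)]) (use assms in auto)

lemma gradient_const [simp]: "gradient (\<lambda>y. c) x = 0"
  by (simp add: gradient_def vec_eq_iff)

lemma laplacian_const [simp]: "laplacian (\<lambda>y. c) = (\<lambda>x. 0)"
proof -
  have "partial_deriv i (\<lambda>y. c) = (\<lambda>y. 0)" for i :: 'a by auto
  then show ?thesis by (intro ext) (simp add: laplacian_eq)
qed

lemma gradient_mult:
  assumes "f differentiable at x" "g differentiable at x"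
  shows "gradient (\<lambda>y. f y * g y) x = f x *\<^sub>R gradient g x + g x *\<^sub>R gradient f x"
  using assms by (simp add: gradient_def vec_eq_iff partial_deriv_mult)

lemma laplacian_mult:
  assumes S: "open S" and x: "x \<in> S" and f: "Ck_on 2 S f" and g: "Ck_on 2 S g"
  shows "laplacian (\<lambda>y. f y * g y) x
    = f x * laplacian g x + 2 * (gradient f x \<bullet> gradient g x) + g x * laplacian f x"
proof -
  note d = Ck_on_2D[OF f] Ck_on_2D[OF g]
  have "partial_deriv i (partial_deriv i (\<lambda>y. f y * g y)) x
      = f x * partial_deriv i (partial_deriv i g) x
        + 2 * (partial_deriv i f x * partial_deriv i g x)
        + g x * partial_deriv i (partial_deriv i f) x" for i
  proof -
    have "partial_deriv i (partial_deriv i (\<lambda>y. f y * g y)) x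
       = partial_deriv i (\<lambda>y. f y * partial_deriv i g y + partial_deriv i f y * g y) x"
      using d by (intro partial_deriv_cong[OF S x] partial_deriv_mult) auto
    also have "\<dots> = f x * partial_deriv i (partial_deriv i g) x
        + 2 * (partial_deriv i f x * partial_deriv i g x)
        + g x * partial_deriv i (partial_deriv i f) x"
      using d x by (subst partial_deriv_add) (auto simp: partial_deriv_mult algebra_simps)
    finally show ?thesis .
  qed
  then show ?thesis
    by (simp add: laplacian_eq inner_vec_def gradient_def sum.distrib sum_distrib_left)
qed

lemma laplacian_cmult:
  assumes "open S" "x \<in> S" "Ck_on 2 S f"
  shows "laplacian (\<lambda>y. c * f y) x = c * laplacian f x"
  using laplacian_mult[OF assms(1,2) Ck_on_const[of 2 S c] assms(3)] by simp

lemma laplacian_sum: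
  assumes S: "open S" and x: "x \<in> S" and f: "\<And>a. a \<in> A \<Longrightarrow> Ck_on 2 S (f a)"
  shows "laplacian (\<lambda>y. \<Sum>a\<in>A. f a y) x = (\<Sum>a\<in>A. laplacian (f a) x)"
proof -
  note d = Ck_on_2D[OF f]
  have "partial_deriv i (partial_deriv i (\<lambda>y. \<Sum>a\<in>A. f a y)) x
      = (\<Sum>a\<in>A. partial_deriv i (partial_deriv i (f a)) x)" for i
  proof -
    have "partial_deriv i (partial_deriv i (\<lambda>y. \<Sum>a\<in>A. f a y)) x
       = partial_deriv i (\<lambda>y. \<Sum>a\<in>A. partial_deriv i (f a) y) x"
      using d by (intro partial_deriv_cong[OF S x] partial_deriv_sum) auto
    with d x show ?thesis by (simp add: partial_deriv_sum)
  qed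
  then show ?thesis by (simp add: laplacian_eq sum.swap[of _ A])
qed

lemma divergence_scaleR_gradient:
  assumes "x \<in> S" "\<phi> differentiable at x" "Ck_on 2 S f"
  shows "divergence (\<lambda>y. \<phi> y *\<^sub>R gradient f y) x
    = \<phi> x * laplacian f x + gradient \<phi> x \<bullet> gradient f x"
proof -
  have "divergence (\<lambda>y. \<phi> y *\<^sub>R gradient f y) x
      = (\<Sum>i\<in>UNIV. partial_deriv i (\<lambda>y. \<phi> y * partial_deriv i f y) x)"
    by (simp add: divergence_def gradient_def)
  also have "\<dots> = \<phi> x * laplacian f x + gradient \<phi> x \<bullet> gradient f x"
    using assms(1,2) Ck_on_2D[OF assms(3)]
    by (simp add: partial_deriv_mult laplacian_eq inner_gradient sum.distrib sum_distrib_left)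
       (simp add: gradient_def)
  finally show ?thesis .
qed

section \<open>Negative powers of the squared radius\<close>

lemma inner_self_eq_sum: "(y::real^'m) \<bullet> y = (\<Sum>k\<in>UNIV. y $ k * y $ k)"
  by (simp add: inner_vec_def)

lemma Ck_on_inner_self: "open S \<Longrightarrow> Ck_on k S (\<lambda>y. y \<bullet> y)"
  unfolding inner_self_eq_sum by (intro Ck_on_intros)

lemma partial_deriv_inner_self: "partial_deriv i (\<lambda>y. y \<bullet> y) x = 2 * x $ i"
  by (subst partial_deriv_eq[OF has_derivative_inner[OF has_derivative_ident has_derivative_ident]])
     (simp add: inner_axis inner_commute[of "axis i 1"])

lemma gradient_inner_self: "gradient (\<lambda>y. y \<bullet> y) x = 2 *\<^sub>R x"
  by (simp add: gradient_def vec_eq_iff partial_deriv_inner_self)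

lemma laplacian_inner_self: "laplacian (\<lambda>y::real^'m. y \<bullet> y) x = 2 * CARD('m)"
proof -
  have eq: "partial_deriv i (\<lambda>y::real^'m. y \<bullet> y) = (\<lambda>x. 2 * x $ i)" for i
    by (auto simp: partial_deriv_inner_self)
  have "(\<lambda>y::real^'m. y $ i) differentiable at x" for i
    using bounded_linear_imp_differentiable bounded_linear_vec_nth by blast
  then show ?thesis by (simp add: laplacian_eq eq partial_deriv_cmult)
qed

lemma open_punctured: "open (UNIV - {0::real^'m})"
  by auto

lemma Ck_on_inverse_radius_power: "Ck_on k (UNIV - {0::real^'m}) (\<lambda>y. inverse (y \<bullet> y) ^ n)"
  by (intro Ck_on_power Ck_on_inverse Ck_on_inner_self open_punctured) auto

lemma gradient_inverse_radius_power:
  fixes x :: "real^'m"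
  assumes "x \<noteq> 0"
  shows "gradient (\<lambda>y. inverse (y \<bullet> y) ^ k) x = (- 2 * real k * inverse (x \<bullet> x) ^ Suc k) *\<^sub>R x"
proof (induction k)
  case (Suc k)
  have x: "x \<in> UNIV - {0}" using assms by simp
  have 1: "gradient (\<lambda>y. inverse (y \<bullet> y)) x = (- 2 * inverse (x \<bullet> x) ^ 2) *\<^sub>R x"
    using assms Ck_on_2D(1)[OF Ck_on_inner_self[OF open_UNIV]]
    by (simp add: gradient_def vec_eq_iff partial_deriv_inverse partial_deriv_inner_self)
  have "gradient (\<lambda>y. inverse (y \<bullet> y) * inverse (y \<bullet> y) ^ k) x
     = inverse (x \<bullet> x) *\<^sub>R gradient (\<lambda>y. inverse (y \<bullet> y) ^ k) x
       + inverse (x \<bullet> x) ^ k *\<^sub>R gradient (\<lambda>y. inverse (y \<bullet> y)) x"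
    using Ck_on_2D(1)[OF Ck_on_inverse_radius_power x, of 1]
          Ck_on_2D(1)[OF Ck_on_inverse_radius_power x, of k]
    by (intro gradient_mult) auto
  also have "\<dots> = (- 2 * real (Suc k) * inverse (x \<bullet> x) ^ Suc (Suc k)) *\<^sub>R x"
    unfolding Suc.IH 1 scaleR_scaleR scaleR_add_left[symmetric]
    by (intro arg_cong2[of _ _ _ _ scaleR] refl) (simp add: algebra_simps power2_eq_square)
  finally show ?case by simp
qed simp

text \<open>
  By the chain rule the gradient of $|x|^{-2k}$ is $-k |x|^{-2k-2}$ times that of $|x|^2$; taking the
  divergence of this product needs only the gradient formula once more, now for exponent $k+1$.
\<close>

lemma laplacian_inverse_radius_power:
  fixes x :: "real^'m"
  assumes "x \<noteq> 0"
  shows "laplacian (\<lambda>y. inverse (y \<bullet> y) ^ k) x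
    = - 2 * real k * (real CARD('m) - 2 * real k - 2) * inverse (x \<bullet> x) ^ Suc k"
proof -
  let ?S = "UNIV - {0::real^'m}"
  let ?r = "\<lambda>k (y::real^'m). inverse (y \<bullet> y) ^ k"
  have x: "x \<in> ?S" using assms by simp
  note d = Ck_on_2D(1)[OF Ck_on_inverse_radius_power]
  have "laplacian (?r k) x = divergence (\<lambda>y. (- real k * ?r (Suc k) y) *\<^sub>R gradient (\<lambda>y. y \<bullet> y) y) x"
    unfolding laplacian_def
    by (intro divergence_cong[OF open_punctured x])
       (simp add: gradient_inverse_radius_power gradient_inner_self del: power_Suc)
  also have "\<dots> = (- real k * ?r (Suc k) x) * (2 * real CARD('m))
      + gradient (\<lambda>y. - real k * ?r (Suc k) y) x \<bullet> (2 *\<^sub>R x)"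
    using d[OF x, of "Suc k"]
    by (subst divergence_scaleR_gradient[OF x])
       (auto simp: laplacian_inner_self gradient_inner_self Ck_on_inner_self open_punctured
         simp del: power_Suc)
  also have "gradient (\<lambda>y. - real k * ?r (Suc k) y) x = - real k *\<^sub>R gradient (?r (Suc k)) x"
    using gradient_mult[of "\<lambda>_. - real k" x "?r (Suc k)"] d[OF x, of "Suc k"]
    by (simp del: power_Suc)
  also have "\<dots> \<bullet> (2 *\<^sub>R x) = 4 * real k * real (Suc k) * (?r (Suc (Suc k)) x * (x \<bullet> x))"
    by (simp add: gradient_inverse_radius_power[OF assms] algebra_simps del: power_Suc)
  also have "?r (Suc (Suc k)) x * (x \<bullet> x) = ?r (Suc k) x"
    using assms by simp
  finally show ?thesis by (simp add: algebra_simps del: power_Suc)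
qed

text \<open>
  The mixed term of the product rule is a radial derivative of \<open>p\<close>, which Euler's relation turns
  into a multiple of \<open>p\<close>.  So multiplication by powers of the radius keeps \<open>p\<close> inside a family on
  which the Laplacian acts by scalars, and it can be iterated without further differentiation.
\<close>

lemma laplacian_harmonic_times_radius_power:
  fixes x :: "real^'m" and d :: real
  assumes "x \<noteq> 0" and p: "Ck_on 2 (UNIV - {0}) p"
    and harm: "laplacian p x = 0" and euler: "gradient p x \<bullet> x = d * p x"
  shows "laplacian (\<lambda>y. p y * inverse (y \<bullet> y) ^ k) x
    = - 2 * real k * (real CARD('m) + 2 * d - 2 * real k - 2) * (p x * inverse (x \<bullet> x) ^ Suc k)"
  using assms(1) laplacian_mult[OF open_punctured _ p Ck_on_inverse_radius_power[of 2 k], of x]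
  by (simp add: harm euler gradient_inverse_radius_power laplacian_inverse_radius_power algebra_simps
       del: power_Suc)

section \<open>Maps into spheres\<close>

text \<open>
  Apply the Laplacian to $|u|^2 = 1$.  This yields the energy density of a map whose coordinates are
  eigenfunctions without computing any gradient.
\<close>

lemma grad_norm_sq_sphere_map:
  fixes x :: "real^'m"
  assumes u: "smooth_sphere_map S n u" and x: "x \<in> S"
  shows "grad_norm_sq n u x = - (\<Sum>a\<le>n. u x a * laplacian (\<lambda>y. u y a) x)"
proof -
  have S: "open S" and C: "\<And>a. a \<le> n \<Longrightarrow> Ck_on 2 S (\<lambda>y. u y a)"
    and one: "\<And>y. y \<in> S \<Longrightarrow> (\<Sum>a\<le>n. u y a * u y a) = 1"
    using u by (auto simp: smooth_sphere_map_def nsphere power2_eq_square)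
  have "0 = laplacian (\<lambda>y. \<Sum>a\<le>n. u y a * u y a) x"
    by (subst laplacian_cong[OF S x one]) auto
  also have "\<dots> = (\<Sum>a\<le>n. laplacian (\<lambda>y. u y a * u y a) x)"
    by (intro laplacian_sum[OF S x] Ck_on_mult[OF S] C) auto
  also have "\<dots> = (\<Sum>a\<le>n. 2 * (u x a * laplacian (\<lambda>y. u y a) x
      + (norm (gradient (\<lambda>y. u y a) x))\<^sup>2))"
    by (intro sum.cong refl, subst laplacian_mult[OF S x C C])
       (auto simp: power2_norm_eq_inner)
  also have "\<dots> = 2 * ((\<Sum>a\<le>n. u x a * laplacian (\<lambda>y. u y a) x) + grad_norm_sq n u x)"
    by (simp add: grad_norm_sq_def sum.distrib flip: sum_distrib_left)
  finally show ?thesis by simp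
qed


text \<open>
  Here $\mu$ is the eigenvalue on the unit sphere of spherical harmonics of degree $2k$, so that
  division by $|x|^{2k}$ makes the first $n$ coordinates homogeneous of degree 0 and still
  eigenfunctions of $|x|^2\Delta$; being of degree 0, they have gradients orthogonal to that of
  the energy density.  The squared radius $\sigma$ of the parallel is fixed by the last equation: it
  makes the bilaplacian of these coordinates cancel twice the divergence term and, because the
  position vector of the parallel has squared length $\sigma$, also balances the coefficient of $u$.
\<close>

theorem proper_biharmonic_of_homogeneous_harmonics:
  fixes p :: "nat \<Rightarrow> real ^ 'm \<Rightarrow> real" and n k :: nat and \<sigma> \<mu> :: real
  defines "u \<equiv> \<lambda>x a. if a < n then p a x * inverse (x \<bullet> x) ^ k
                      else if a = n then sqrt (1 - \<sigma>) else 0"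
  assumes smooth: "\<And>a j. a < n \<Longrightarrow> Ck_on j (UNIV - {0}) (p a)"
    and harm: "\<And>a x. a < n \<Longrightarrow> x \<noteq> 0 \<Longrightarrow> laplacian (p a) x = 0"
    and euler: "\<And>a x. a < n \<Longrightarrow> x \<noteq> 0 \<Longrightarrow> gradient (p a) x \<bullet> x = real (2 * k) * p a x"
    and norm: "\<And>x. x \<noteq> 0 \<Longrightarrow> (\<Sum>a<n. (p a x)\<^sup>2) = \<sigma> * (x \<bullet> x) ^ (2 * k)"
    and \<mu>: "\<mu> = real (2 * k) * (real CARD('m) + real (2 * k) - 2)" "\<mu> \<noteq> 0"
    and \<sigma>: "0 < \<sigma>" "\<sigma> < 1" "2 * \<sigma> * \<mu> = \<mu> + 2 * (real CARD('m) - 4)"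
  shows "proper_biharmonic_sphere_map (UNIV - {0}) n u"
proof -
  let ?S = "UNIV - {0::real^'m}"
  define r where "r = (\<lambda>x::real^'m. inverse (x \<bullet> x))"
  have r: "r x \<noteq> 0" "r x * (x \<bullet> x) = 1" if "x \<noteq> 0" for x
    using that by (auto simp: r_def)
  have u_less: "(\<lambda>y. u y a) = (\<lambda>y. p a y * r y ^ k)" if "a < n" for a
    using that by (simp add: u_def r_def)
  have u_n: "(\<lambda>y. u y n) = (\<lambda>y. sqrt (1 - \<sigma>))"
    by (simp add: u_def)
  have Ck_r: "Ck_on j ?S (\<lambda>y. r y ^ l)" for j l
    unfolding r_def by (rule Ck_on_inverse_radius_power)
  have grad_r: "gradient (\<lambda>y. r y ^ l) x = (- 2 * real l * r x ^ Suc l) *\<^sub>R x" if "x \<noteq> 0" for l x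
    unfolding r_def using that by (rule gradient_inverse_radius_power)
  have Ck_u: "Ck_on j ?S (\<lambda>y. u y a)" if "a \<le> n" for a j
    using that smooth Ck_r u_n
    by (cases "a = n") (auto simp: u_less intro!: Ck_on_mult open_punctured)
  have sum_sq: "(\<Sum>a<n. (u x a)\<^sup>2) = \<sigma>" if "x \<noteq> 0" for x
  proof -
    have "(\<Sum>a<n. (u x a)\<^sup>2) = (\<Sum>a<n. (p a x)\<^sup>2 * r x ^ (2 * k))"
      by (intro sum.cong) (auto simp: u_def r_def power_mult_distrib power_mult mult.commute[of 2])
    also have "\<dots> = \<sigma> * (r x * (x \<bullet> x)) ^ (2 * k)"
      by (simp add: norm[OF that] power_mult_distrib flip: sum_distrib_right)
    finally show ?thesis by (simp add: r(2)[OF that])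
  qed
  have smooth_u: "smooth_sphere_map ?S n u"
    using \<sigma> Ck_u open_punctured
    by (auto simp: smooth_sphere_map_def nsphere sum_sq lessThan_Suc_atMost[symmetric])
       (auto simp: u_def)

  have lap_less: "laplacian (\<lambda>y. u y a) x = - \<mu> * (p a x * r x ^ Suc k)"
    if "a < n" "x \<noteq> 0" for a x
    using laplacian_harmonic_times_radius_power[OF that(2) smooth harm euler, of a k] that
    by (simp add: u_less \<mu>(1) r_def algebra_simps)
  then have lap: "laplacian (\<lambda>y. u y a) x = - \<mu> * r x * u x a"
    if "a < n" "x \<noteq> 0" for a x
    using that by (simp add: fun_cong[OF u_less])
  \<comment> \<open>the second Laplacian acts on a function of degree \<open>-2\<close>, by minus the scalar on the right\<close>
  have \<sigma>\<mu>: "2 * \<sigma> * \<mu> = 2 * real (Suc k) * (real CARD('m) + 2 * real (2 * k) - 2 * real (Suc k) - 2)"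
    by (subst \<sigma>(3), subst \<mu>(1)) (simp add: algebra_simps)
  have bilap: "laplacian (laplacian (\<lambda>y. u y a)) x = 2 * \<sigma> * \<mu>\<^sup>2 * (r x)\<^sup>2 * u x a"
    if "a < n" "x \<noteq> 0" for a x
  proof -
    have "laplacian (laplacian (\<lambda>y. u y a)) x = laplacian (\<lambda>y. - \<mu> * (p a y * r y ^ Suc k)) x"
      by (rule laplacian_cong[OF open_punctured]) (use that lap_less in auto)
    also have "\<dots> = - \<mu> * laplacian (\<lambda>y. p a y * r y ^ Suc k) x"
      using that by (intro laplacian_cmult[OF open_punctured] Ck_on_mult open_punctured smooth Ck_r) auto
    also have "laplacian (\<lambda>y. p a y * r y ^ Suc k) x = - (2 * \<sigma> * \<mu>) * (p a x * r x ^ Suc (Suc k))"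
      using laplacian_harmonic_times_radius_power[OF that(2) smooth harm euler, of a "Suc k"] that
      by (simp add: \<sigma>\<mu> r_def del: power_Suc of_nat_Suc of_nat_mult)
    finally show ?thesis
      using that by (simp add: fun_cong[OF u_less] power2_eq_square)
  qed
  \<comment> \<open>the exponent 1 lets the rules for powers of \<open>r\<close> apply to the energy density\<close>
  have gns: "grad_norm_sq n u x = \<sigma> * \<mu> * r x ^ 1" if "x \<noteq> 0" for x
  proof -
    have "grad_norm_sq n u x = - (\<Sum>a<n. u x a * laplacian (\<lambda>y. u y a) x)"
      using that by (simp add: grad_norm_sq_sphere_map[OF smooth_u] u_n flip: lessThan_Suc_atMost)
    also have "\<dots> = (\<Sum>a<n. \<mu> * r x * (u x a)\<^sup>2)"
      using that by (simp add: lap power2_eq_square algebra_simps flip: sum_negf)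
    also have "\<dots> = \<sigma> * \<mu> * r x ^ 1"
      by (simp add: sum_sq that flip: sum_distrib_left)
    finally show ?thesis .
  qed
  \<comment> \<open>Euler's relation in degree 0, by which the cross term of the divergence vanishes\<close>
  have radial: "gradient (\<lambda>y. u y a) x \<bullet> x = 0" if "a < n" "x \<noteq> 0" for a x
  proof -
    have "gradient (\<lambda>y. u y a) x \<bullet> x = real (2 * k) * p a x * r x ^ k * (1 - r x * (x \<bullet> x))"
      unfolding u_less[OF that(1)]
      using that Ck_on_2D(1)[OF smooth] Ck_on_2D(1)[OF Ck_r]
      by (subst gradient_mult)
         (auto simp: grad_r inner_add_left euler algebra_simps)
    then show ?thesis by (simp add: r(2)[OF that(2)])
  qed
  have div: "divergence (\<lambda>y. grad_norm_sq n u y *\<^sub>R gradient (\<lambda>z. u z a) y) x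
      = - \<sigma> * \<mu>\<^sup>2 * (r x)\<^sup>2 * u x a" if "a < n" "x \<noteq> 0" for a x
  proof -
    have x: "x \<in> ?S" using that by simp
    have dr: "(\<lambda>y. r y ^ 1) differentiable at x" by (rule Ck_on_2D(1)[OF Ck_r x])
    have "divergence (\<lambda>y. grad_norm_sq n u y *\<^sub>R gradient (\<lambda>z. u z a) y) x
       = divergence (\<lambda>y. (\<sigma> * \<mu> * r y ^ 1) *\<^sub>R gradient (\<lambda>z. u z a) y) x"
      by (rule divergence_cong[OF open_punctured x]) (use gns in auto)
    also have "\<dots> = \<sigma> * \<mu> * r x ^ 1 * laplacian (\<lambda>y. u y a) x
        + gradient (\<lambda>y. \<sigma> * \<mu> * r y ^ 1) x \<bullet> gradient (\<lambda>z. u z a) x"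
      using dr Ck_u that by (intro divergence_scaleR_gradient[OF x]) auto
    also have "gradient (\<lambda>y. \<sigma> * \<mu> * r y ^ 1) x = (\<sigma> * \<mu>) *\<^sub>R gradient (\<lambda>y. r y ^ 1) x"
      using gradient_mult[OF differentiable_const dr, of "\<sigma> * \<mu>"] by simp
    also have "\<dots> \<bullet> gradient (\<lambda>z. u z a) x = 0"
      using radial[OF that] by (simp only: grad_r[OF that(2)]) (simp add: inner_commute)
    finally show ?thesis using that by (simp add: lap power2_eq_square)
  qed
  have "biharmonic_sphere_map ?S n u"
    unfolding biharmonic_sphere_map_def
  proof (intro conjI ballI allI impI smooth_u)
    fix x :: "real^'m" and a assume "x \<in> ?S" and a: "a \<le> n"
    then have x: "x \<noteq> 0" by simp
    have "(\<Sum>b\<le>n. laplacian (laplacian (\<lambda>y. u y b)) x * u x b)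
        = (\<Sum>b<n. 2 * \<sigma> * \<mu>\<^sup>2 * (r x)\<^sup>2 * (u x b)\<^sup>2)"
      using x by (simp add: bilap u_n power2_eq_square mult.assoc flip: lessThan_Suc_atMost)
    also have "\<dots> = 2 * (grad_norm_sq n u x)\<^sup>2"
      using sum_sq[OF x]
      by (simp add: gns x power_mult_distrib flip: sum_distrib_left) (simp add: power2_eq_square)
    finally have bracket: "(\<Sum>b\<le>n. laplacian (laplacian (\<lambda>y. u y b)) x * u x b)
        = 2 * (grad_norm_sq n u x)\<^sup>2" .
    have "laplacian (laplacian (\<lambda>y. u y a)) x
        + 2 * divergence (\<lambda>y. grad_norm_sq n u y *\<^sub>R gradient (\<lambda>z. u z a) y) x = 0"
    proof (cases "a = n")
      case True
      then show ?thesis by (simp add: u_n divergence_def)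
    next
      case False
      with a x show ?thesis by (simp add: bilap div)
    qed
    then show "laplacian (laplacian (\<lambda>y. u y a)) x
        + 2 * divergence (\<lambda>y. grad_norm_sq n u y *\<^sub>R gradient (\<lambda>z. u z a) y) x
        - ((\<Sum>b\<le>n. laplacian (laplacian (\<lambda>y. u y b)) x * u x b)
           - 2 * (grad_norm_sq n u x)\<^sup>2) * u x a = 0"
      by (simp add: bracket)
  qed
  moreover have "\<not> harmonic_sphere_map ?S n u"
  proof
    assume "harmonic_sphere_map ?S n u"
    moreover obtain x :: "real^'m" where x: "x \<noteq> 0" using axis_eq_0_iff[of _ "1::real"] by fastforce
    ultimately have "laplacian (\<lambda>y. u y n) x + grad_norm_sq n u x * u x n = 0"
      by (auto simp: harmonic_sphere_map_def)
    with \<sigma> \<mu>(2) r(1)[OF x] show False by (simp add: gns[OF x] u_n fun_cong[OF u_n])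
  qed
  ultimately show ?thesis by (simp add: proper_biharmonic_sphere_map_def)
qed

section \<open>The traceless symmetric square\<close>

text \<open>
  These functions are indexed by ordered pairs, so the off-diagonal ones occur twice.  This gives
  exactly $m^2$ coordinates and makes the sum of squares the squared Frobenius norm of the traceless part
  of the matrix $x x^T$.
\<close>

definition traceless_square :: "'m \<times> 'm \<Rightarrow> real ^ 'm \<Rightarrow> real" where
  "traceless_square = (\<lambda>(i, j) x. x $ i * x $ j - (if i = j then (x \<bullet> x) / real CARD('m) else 0))"

lemma traceless_square_eq:
  "traceless_square (i, j) = (\<lambda>x::real^'m. x $ i * x $ j + (if i = j then - 1 / real CARD('m) else 0) * (x \<bullet> x))"
  by (auto simp: traceless_square_def)

lemma Ck_on_traceless_square: "open S \<Longrightarrow> Ck_on k S (traceless_square ij)"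
  by (cases ij) (auto simp only: traceless_square_eq intro!: Ck_on_intros Ck_on_inner_self)

lemma partial_deriv_traceless_square:
  "partial_deriv l (traceless_square (i, j)) (x::real^'m)
     = (if l = j then x $ i else 0) + (if l = i then x $ j else 0)
       - (if i = j then 2 / real CARD('m) * x $ l else 0)"
proof -
  have d: "(\<lambda>y::real^'m. y $ i) differentiable at x" "(\<lambda>y::real^'m. y \<bullet> y) differentiable at x" for i
    using Ck_on_2D(1)[OF Ck_on_component[of 2 UNIV]] Ck_on_2D(1)[OF Ck_on_inner_self[of UNIV 2]]
    by auto
  then show ?thesis
    by (simp add: traceless_square_eq partial_deriv_add partial_deriv_mult partial_deriv_inner_self)
qed

lemma gradient_traceless_square:
  "gradient (traceless_square ij) (x::real^'m) \<bullet> x = 2 * traceless_square ij x"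
proof (cases ij)
  case (Pair i j)
  let ?m = "real CARD('m)"
  have "gradient (traceless_square (i, j)) x \<bullet> x
     = (\<Sum>l\<in>UNIV. (if l = j then x $ i * x $ l else 0) + (if l = i then x $ j * x $ l else 0)
         - (if i = j then 2 / ?m else 0) * (x $ l * x $ l))"
    unfolding inner_gradient partial_deriv_traceless_square
    by (intro sum.cong refl) (simp add: algebra_simps)
  also have "\<dots> = x $ i * x $ j + x $ j * x $ i - (if i = j then 2 / ?m else 0) * (x \<bullet> x)"
    by (simp add: sum.distrib sum_subtractf inner_self_eq_sum flip: sum_distrib_left)
  also have "\<dots> = 2 * traceless_square (i, j) x"
    by (simp add: traceless_square_def)
  finally show ?thesis by (simp add: Pair)
qed

lemma laplacian_traceless_square: "laplacian (traceless_square ij) (x::real^'m) = 0"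
proof (cases ij)
  case (Pair i j)
  let ?m = "real CARD('m)" and ?\<delta> = "\<lambda>(a::'m) b. if a = b then 1 else 0 :: real"
  have d: "(\<lambda>y::real^'m. c * y $ i) differentiable at x" "(\<lambda>y::real^'m. y $ i) differentiable at x"
    for c i
    by (rule Ck_on_2D(1)[where S = UNIV], intro Ck_on_intros; simp)+
  have "partial_deriv l (partial_deriv l (traceless_square (i, j))) x
      = 2 * (if l = i then ?\<delta> i j else 0) - ?\<delta> i j * 2 / ?m" for l
  proof -
    have "partial_deriv l (traceless_square (i, j))
        = (\<lambda>y. ?\<delta> l j * y $ i + (?\<delta> l i * y $ j + ?\<delta> i j * (- 2 / ?m) * y $ l))"
      by (intro ext) (simp add: partial_deriv_traceless_square)
    then have "partial_deriv l (partial_deriv l (traceless_square (i, j))) x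
        = ?\<delta> l j * ?\<delta> l i + (?\<delta> l i * ?\<delta> l j + ?\<delta> i j * (- 2 / ?m))"
      by (simp only: partial_deriv_add partial_deriv_cmult partial_deriv_component d
          differentiable_add) simp
    then show ?thesis by auto
  qed
  then show ?thesis
    by (simp add: Pair laplacian_eq sum_subtractf flip: sum_distrib_left)
qed

text \<open>
  The matrix $x x^T$ has Frobenius norm and trace $|x|^2$; removing the trace part
  $|x|^2/m$ times the identity subtracts $|x|^4/m$ from the squared norm.
\<close>

lemma sum_traceless_square:
  "(\<Sum>ij\<in>UNIV. (traceless_square ij (x::real^'m))\<^sup>2) = (1 - 1 / real CARD('m)) * (x \<bullet> x)\<^sup>2"
proof -
  let ?m = "real CARD('m)"
  define c where "c = 2 * (x \<bullet> x) / ?m"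
  have sums: "(\<Sum>i\<in>UNIV. \<Sum>j\<in>UNIV. (x $ i * x $ i) * (x $ j * x $ j)) = (x \<bullet> x) * (x \<bullet> x)"
    "(\<Sum>i\<in>UNIV. c * (x $ i * x $ i)) = c * (x \<bullet> x)"
    by (simp only: inner_self_eq_sum sum_product) (simp only: inner_self_eq_sum sum_distrib_left)
  have "(\<Sum>ij\<in>UNIV. (traceless_square ij x)\<^sup>2)
     = (\<Sum>i\<in>UNIV. \<Sum>j\<in>UNIV. (traceless_square (i, j) x)\<^sup>2)"
    by (simp add: sum.cartesian_product)
  also have "\<dots> = (\<Sum>i\<in>UNIV. \<Sum>j\<in>UNIV. (x $ i * x $ i) * (x $ j * x $ j)
     + (if j = i then (x \<bullet> x)\<^sup>2 / ?m\<^sup>2 - c * (x $ i * x $ i) else 0))"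
    by (intro sum.cong refl)
       (auto simp: traceless_square_def c_def power2_eq_square field_simps)
  also have "\<dots> = (x \<bullet> x) * (x \<bullet> x) + ?m * ((x \<bullet> x)\<^sup>2 / ?m\<^sup>2) - c * (x \<bullet> x)"
    by (simp add: sum.distrib sum_subtractf sums)
  also have "\<dots> = (1 - 1 / ?m) * (x \<bullet> x)\<^sup>2"
    by (simp add: c_def power2_eq_square field_simps)
  finally show ?thesis .
qed

theorem corollary3p6:
  assumes "CARD('m::finite) \<ge> 3"
  shows "\<exists>l::nat. 1 \<le> l \<and> l \<le> CARD('m) \<and>
    (\<exists>u :: real ^ 'm \<Rightarrow> nat \<Rightarrow> real.
       proper_biharmonic_sphere_map (UNIV - {0}) (CARD('m) ^ l) u)"
proof -
  let ?m = "real CARD('m)"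
  define \<sigma> where "\<sigma> = (?m - 2) / ?m"
  \<comment> \<open>scales the squared norm $1 - 1/m$ of the normalised square to \<open>\<sigma>\<close>\<close>
  define K where "K = sqrt ((?m - 2) / (?m - 1))"
  have m: "?m \<ge> 3" using assms by simp
  have K: "K\<^sup>2 * (1 - 1 / ?m) = \<sigma>"
    using m by (simp add: K_def \<sigma>_def field_simps)
  obtain h where h: "bij_betw h {..<CARD('m) ^ 2} (UNIV :: ('m \<times> 'm) set)"
    using ex_bij_betw_nat_finite[of "UNIV :: ('m \<times> 'm) set"]
    by (auto simp: card_prod power2_eq_square atLeast0LessThan)
  let ?p = "\<lambda>a (x::real^'m). K * traceless_square (h a) x"
  note C = Ck_on_traceless_square[OF open_punctured]
  have d: "traceless_square ij differentiable at x" for ij and x :: "real^'m"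
    by (rule Ck_on_2D(1)[OF Ck_on_traceless_square[OF open_UNIV]]) simp
  have "proper_biharmonic_sphere_map (UNIV - {0}) (CARD('m) ^ 2)
     (\<lambda>x a. if a < CARD('m) ^ 2 then ?p a x * inverse (x \<bullet> x) ^ 1
            else if a = CARD('m) ^ 2 then sqrt (1 - \<sigma>) else 0)"
  proof (rule proper_biharmonic_of_homogeneous_harmonics[where \<mu> = "2 * ?m"])
    fix a j and x :: "real^'m" assume x: "x \<noteq> 0"
    show "laplacian (?p a) x = 0"
      using x by (subst laplacian_cmult[OF open_punctured _ C]) (auto simp: laplacian_traceless_square)
    show "gradient (?p a) x \<bullet> x = real (2 * 1) * ?p a x"
      using gradient_mult[OF differentiable_const d, of K]
      by (simp add: gradient_traceless_square)
  next
    fix x :: "real^'m"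
    have "(\<Sum>a<CARD('m) ^ 2. (?p a x)\<^sup>2) = (\<Sum>ij\<in>UNIV. (K * traceless_square ij x)\<^sup>2)"
      using h by (rule sum.reindex_bij_betw)
    also have "\<dots> = \<sigma> * (x \<bullet> x) ^ (2 * 1)"
      by (simp add: power_mult_distrib sum_traceless_square flip: sum_distrib_left K)
    finally show "(\<Sum>a<CARD('m) ^ 2. (?p a x)\<^sup>2) = \<sigma> * (x \<bullet> x) ^ (2 * 1)" .
  qed (use m in \<open>auto simp: \<sigma>_def field_simps intro!: Ck_on_mult C open_punctured\<close>)
  then show ?thesis using assms by (intro exI[of _ 2]) auto
qed

end
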